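(* Let $R$ be a commutative ring with identity $1\neq 0$ and let $I$ be an ideal of $R$ with $I\subseteq \mathrm{Nil}(R)$. Then $\overline{\Gamma}(R\Join I)=\Gamma(R\Join I)$ if and only if $\overline{\Gamma}(R)=\Gamma(R)$.
   Context: For a commutative ring $A$ with $1\neq 0$, $Z(A)$ is the set of zero-divisors of $A$ (including $0$), $Z(A)^*=Z(A)\setminus\{0\}$, and $\mathrm{Nil}(A)$ is the set of nilpotent elements of $A$. The zero-divisor graph $\Gamma(A)$ is the simple graph with vertex set $Z(A)^*$ in which distinct vertices $x,y$ are adjacent if and only if $xy=0$. The extended zero-divisor graph $\overline{\Gamma}(A)$ is the simple graph with the same vertex set $Z(A)^*$ in which distinct vertices $x,y$ are adjacent if and only if there exist integers $n,m\geq 1$ with $x^ny^m=0$, $x^n\neq 0$ and $y^m\neq 0$. Equality of two graphs on the same vertex set means that they have the same edges. For an ideal $I$ of $R$, the amalgamated duplication of $R$ along $I$ is the subring $R\Join I=\{(r,r+i) : r\in R,\ i\in I\}$ of $R\times R$. *)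

theory Defs
  imports "HOL-Algebra.Algebra"
begin

definition nilpotents :: "('a, 'b) ring_scheme \<Rightarrow> 'a set" where
  "nilpotents A = {x \<in> carrier A. \<exists>n::nat. n \<ge> 1 \<and> x [^]\<^bsub>A\<^esub> n = \<zero>\<^bsub>A\<^esub>}"

(* Contains 0 as soon as A is a nonzero ring. *)
definition zero_divisors :: "('a, 'b) ring_scheme \<Rightarrow> 'a set" where
  "zero_divisors A =
     {x \<in> carrier A. \<exists>y \<in> carrier A. y \<noteq> \<zero>\<^bsub>A\<^esub> \<and> x \<otimes>\<^bsub>A\<^esub> y = \<zero>\<^bsub>A\<^esub>}"

abbreviation nonzero_zero_divisors :: "('a, 'b) ring_scheme \<Rightarrow> 'a set" where
  "nonzero_zero_divisors A \<equiv> zero_divisors A - {\<zero>\<^bsub>A\<^esub>}"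

(* A simple graph is the pair of its vertex set and its set of edges, the edges being
   two-element subsets of the vertex set; equality of graphs is equality of pairs. *)
type_synonym 'a simple_graph = "'a set \<times> 'a set set"

definition zero_divisor_graph :: "('a, 'b) ring_scheme \<Rightarrow> 'a simple_graph" where
  "zero_divisor_graph A =
     (nonzero_zero_divisors A,
      {{x, y} | x y. x \<in> nonzero_zero_divisors A \<and> y \<in> nonzero_zero_divisors A \<and> x \<noteq> y \<and>
         x \<otimes>\<^bsub>A\<^esub> y = \<zero>\<^bsub>A\<^esub>})"

definition extended_zero_divisor_graph :: "('a, 'b) ring_scheme \<Rightarrow> 'a simple_graph" where
  "extended_zero_divisor_graph A =
     (nonzero_zero_divisors A,
      {{x, y} | x y. x \<in> nonzero_zero_divisors A \<and> y \<in> nonzero_zero_divisors A \<and> x \<noteq> y \<and>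
         (\<exists>(n::nat) (m::nat). n \<ge> 1 \<and> m \<ge> 1 \<and>
            x [^]\<^bsub>A\<^esub> n \<otimes>\<^bsub>A\<^esub> y [^]\<^bsub>A\<^esub> m = \<zero>\<^bsub>A\<^esub> \<and>
            x [^]\<^bsub>A\<^esub> n \<noteq> \<zero>\<^bsub>A\<^esub> \<and> y [^]\<^bsub>A\<^esub> m \<noteq> \<zero>\<^bsub>A\<^esub>)})"

definition amalgamated_duplication_carrier ::
    "('a, 'b) ring_scheme \<Rightarrow> 'a set \<Rightarrow> ('a \<times> 'a) set" where
  "amalgamated_duplication_carrier R I = {(r, r \<oplus>\<^bsub>R\<^esub> i) | r i. r \<in> carrier R \<and> i \<in> I}"

definition amalgamated_duplication ::
    "('a, 'b) ring_scheme \<Rightarrow> 'a set \<Rightarrow> ('a \<times> 'a) ring" where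
  "amalgamated_duplication R I =
     (RDirProd R R) \<lparr> carrier := amalgamated_duplication_carrier R I \<rparr>"

lemma amalgamated_duplication_simps:
  "carrier (amalgamated_duplication R I) = amalgamated_duplication_carrier R I"
  "p \<otimes>\<^bsub>amalgamated_duplication R I\<^esub> q =
     (fst p \<otimes>\<^bsub>R\<^esub> fst q, snd p \<otimes>\<^bsub>R\<^esub> snd q)"
  "p \<oplus>\<^bsub>amalgamated_duplication R I\<^esub> q =
     (fst p \<oplus>\<^bsub>R\<^esub> fst q, snd p \<oplus>\<^bsub>R\<^esub> snd q)"
  "\<one>\<^bsub>amalgamated_duplication R I\<^esub> = (\<one>\<^bsub>R\<^esub>, \<one>\<^bsub>R\<^esub>)"
  "\<zero>\<^bsub>amalgamated_duplication R I\<^esub> = (\<zero>\<^bsub>R\<^esub>, \<zero>\<^bsub>R\<^esub>)"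
  by (simp_all add: amalgamated_duplication_def RDirProd_def DirProd_def monoid.defs
      case_prod_unfold)

lemma amalgamated_duplication_cring:
  fixes R (structure)
  assumes "cring R" and "ideal I R"
  shows "cring (amalgamated_duplication R I)"
proof -
  interpret cring R by fact
  interpret I: ideal I R by fact
  note S = amalgamated_duplication_simps amalgamated_duplication_carrier_def
  have Ic: "i \<in> carrier R" if "i \<in> I" for i
    using that by (rule I.Icarr)
  have mult: "\<exists>k. (r \<oplus> i) \<otimes> (s \<oplus> j) = r \<otimes> s \<oplus> k \<and> k \<in> I"
    if "r \<in> carrier R" "s \<in> carrier R" "i \<in> I" "j \<in> I" for r s i j
  proof (intro exI conjI)
    show "(r \<oplus> i) \<otimes> (s \<oplus> j) = r \<otimes> s \<oplus> (r \<otimes> j \<oplus> i \<otimes> (s \<oplus> j))"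
      using that Ic by (simp add: l_distr r_distr a_ac)
    show "r \<otimes> j \<oplus> i \<otimes> (s \<oplus> j) \<in> I"
      using that Ic by (intro I.a_closed I.I_l_closed I.I_r_closed) auto
  qed
  have add: "\<exists>k. (r \<oplus> i) \<oplus> (s \<oplus> j) = r \<oplus> s \<oplus> k \<and> k \<in> I"
    if "r \<in> carrier R" "s \<in> carrier R" "i \<in> I" "j \<in> I" for r s i j
    using that Ic by (intro exI[of _ "i \<oplus> j"]) (auto simp: a_ac)
  have unit: "\<exists>k. x = x \<oplus> k \<and> k \<in> I" if "x \<in> carrier R" for x
    using that by (intro exI[of _ \<zero>]) auto
  have neg: "\<exists>q\<in>carrier (amalgamated_duplication R I).
      q \<oplus>\<^bsub>amalgamated_duplication R I\<^esub> p = \<zero>\<^bsub>amalgamated_duplication R I\<^esub>"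
    if p: "p \<in> carrier (amalgamated_duplication R I)" for p
  proof -
    obtain r i where ri: "p = (r, r \<oplus> i)" "r \<in> carrier R" "i \<in> I"
      using p by (auto simp: S)
    have "(\<ominus> r, \<ominus> r \<oplus> \<ominus> i) \<in> carrier (amalgamated_duplication R I)"
      using ri by (auto simp: S)
    moreover have "\<ominus> r \<oplus> \<ominus> i \<oplus> (r \<oplus> i) = \<zero>"
      using ri Ic by (metis a_inv_closed add.inv_closed l_neg minus_add add.m_closed)
    ultimately show ?thesis
      using ri Ic by (intro bexI[of _ "(\<ominus> r, \<ominus> r \<oplus> \<ominus> i)"]) (auto simp: S l_neg)
  qed
  show ?thesis
  proof (intro cringI abelian_groupI comm_monoidI)
    show "\<exists>y\<in>carrier (amalgamated_duplication R I).
        y \<oplus>\<^bsub>amalgamated_duplication R I\<^esub> x = \<zero>\<^bsub>amalgamated_duplication R I\<^esub>"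
      if "x \<in> carrier (amalgamated_duplication R I)" for x
      using neg that .
  qed (use mult add unit Ic in \<open>auto simp: S m_ac a_ac l_distr r_distr\<close>)
qed

end

theory Submission
  imports Defs
begin

text \<open>
  Equality of the two graphs says that \<open>x\<^sup>n y\<^sup>m = 0\<close> with \<open>x\<^sup>n \<noteq> 0 \<noteq> y\<^sup>m\<close> forces \<open>x y = 0\<close>
  for distinct \<open>x, y\<close>. Applied to a nilpotent \<open>x\<close> of index \<open>k \<ge> 3\<close> and \<open>y = x + x\<^sup>k\<^sup>-\<^sup>1\<close> it
  would give \<open>x\<^sup>2 = x y = 0\<close>; hence every nilpotent has square zero and the restriction
  \<open>x \<noteq> y\<close> can be dropped. The condition passes to the diagonal copy of \<open>R\<close> in \<open>R \<Join> I\<close>.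
  Conversely, it lifts to \<open>R \<Join> I\<close> componentwise: if a component of a power \<open>(r, r + i)\<^sup>n \<noteq> 0\<close>
  vanishes, then both \<open>r\<close> and \<open>r + i\<close> have square zero, so \<open>n = 1\<close> and that component of
  \<open>(r, r + i)\<close> is itself zero.
\<close>

text \<open>The variables range over the whole carrier: the premises already force \<open>x\<close>
  and \<open>y\<close> to be nonzero zero-divisors, so the vertex condition of the graphs is
  absorbed.\<close>

definition power_annihilation :: "('a, 'b) ring_scheme \<Rightarrow> bool" where
  "power_annihilation A \<longleftrightarrow>
     (\<forall>x \<in> carrier A. \<forall>y \<in> carrier A. \<forall>(n::nat) (m::nat). x \<noteq> y \<longrightarrow>
        x [^]\<^bsub>A\<^esub> n \<otimes>\<^bsub>A\<^esub> y [^]\<^bsub>A\<^esub> m = \<zero>\<^bsub>A\<^esub> \<longrightarrow>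
        x [^]\<^bsub>A\<^esub> n \<noteq> \<zero>\<^bsub>A\<^esub> \<longrightarrow> y [^]\<^bsub>A\<^esub> m \<noteq> \<zero>\<^bsub>A\<^esub> \<longrightarrow> n \<ge> 1 \<longrightarrow> m \<ge> 1 \<longrightarrow>
        x \<otimes>\<^bsub>A\<^esub> y = \<zero>\<^bsub>A\<^esub>)"

context cring
begin

text \<open>In the sequence \<open>z\<close>, \<open>x z\<close>, \<open>x^2 z\<close>, ... the last
  nonzero term is annihilated by \<open>x\<close>.\<close>

lemma zero_divisor_if_pow_mult_zero:
  fixes n :: nat
  assumes "x \<in> carrier R" "z \<in> carrier R" "z \<noteq> \<zero>" "x [^] n \<otimes> z = \<zero>"
  shows "x \<in> zero_divisors R"
  using assms(4)
proof (induction n)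
  case 0
  then show ?case using assms by simp
next
  case (Suc n)
  have "x \<otimes> (x [^] n \<otimes> z) = \<zero>"
    using Suc.prems assms(1,2) by (simp add: m_ac)
  then show ?case
    using Suc.IH assms(1,2) unfolding zero_divisors_def by blast
qed

text \<open>Exponents \<open>n = m = 1\<close> turn every edge of the ordinary graph into one of the
  extended graph, so only the reverse inclusion is a condition on the ring.\<close>

lemma extended_graph_eq_iff:
  "extended_zero_divisor_graph R = zero_divisor_graph R \<longleftrightarrow> power_annihilation R"
proof
  assume eq: "extended_zero_divisor_graph R = zero_divisor_graph R"
  show "power_annihilation R"
    unfolding power_annihilation_def
  proof (intro ballI allI impI)
    fix x y and n m :: nat
    assume xy: "x \<in> carrier R" "y \<in> carrier R" "x \<noteq> y"
      and z: "x [^] n \<otimes> y [^] m = \<zero>" and nz: "x [^] n \<noteq> \<zero>" "y [^] m \<noteq> \<zero>"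
      and nm: "n \<ge> 1" "m \<ge> 1"
    have "y [^] m \<otimes> x [^] n = \<zero>"
      using z xy by (simp add: m_comm)
    then have zd: "x \<in> zero_divisors R" "y \<in> zero_divisors R"
      using zero_divisor_if_pow_mult_zero z nz xy nat_pow_closed by blast+
    have "x \<noteq> \<zero>" "y \<noteq> \<zero>"
      using nz nm by (auto simp: nat_pow_zero)
    then have "{x, y} \<in> snd (extended_zero_divisor_graph R)"
      unfolding extended_zero_divisor_graph_def using zd z nz nm \<open>x \<noteq> y\<close> by auto
    then have "{x, y} \<in> snd (zero_divisor_graph R)"
      using eq by simp
    then obtain u v where "{x, y} = {u, v}" "u \<otimes> v = \<zero>"
      unfolding zero_divisor_graph_def by auto
    then show "x \<otimes> y = \<zero>"
      using xy by (auto simp: doubleton_eq_iff m_comm)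
  qed
next
  assume pa: "power_annihilation R"
  have "(\<exists>(n::nat) (m::nat). n \<ge> 1 \<and> m \<ge> 1 \<and>
            x [^] n \<otimes> y [^] m = \<zero> \<and> x [^] n \<noteq> \<zero> \<and> y [^] m \<noteq> \<zero>) \<longleftrightarrow> x \<otimes> y = \<zero>"
    if "x \<in> nonzero_zero_divisors R" "y \<in> nonzero_zero_divisors R" "x \<noteq> y" for x y
  proof
    have c: "x \<in> carrier R" "y \<in> carrier R"
      using that by (auto simp: zero_divisors_def)
    show "x \<otimes> y = \<zero>" if "\<exists>(n::nat) (m::nat). n \<ge> 1 \<and> m \<ge> 1 \<and>
            x [^] n \<otimes> y [^] m = \<zero> \<and> x [^] n \<noteq> \<zero> \<and> y [^] m \<noteq> \<zero>"
      using that pa c \<open>x \<noteq> y\<close> unfolding power_annihilation_def by blast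
    show "\<exists>(n::nat) (m::nat). n \<ge> 1 \<and> m \<ge> 1 \<and>
            x [^] n \<otimes> y [^] m = \<zero> \<and> x [^] n \<noteq> \<zero> \<and> y [^] m \<noteq> \<zero>" if "x \<otimes> y = \<zero>"
      using that c \<open>x \<in> nonzero_zero_divisors R\<close> \<open>y \<in> nonzero_zero_divisors R\<close>
      by (intro exI[of _ "1::nat"]) auto
  qed
  then show "extended_zero_divisor_graph R = zero_divisor_graph R"
    unfolding extended_zero_divisor_graph_def zero_divisor_graph_def by (simp cong: conj_cong)
qed

lemma pow_zero_mono:
  fixes n k :: nat
  assumes "x \<in> carrier R" "x [^] k = \<zero>" "k \<le> n"
  shows "x [^] n = \<zero>"
proof -
  have "x [^] n = x [^] k \<otimes> x [^] (n - k)"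
    using assms(1,3) by (simp add: nat_pow_mult)
  then show ?thesis using assms by simp
qed

lemma nilpotent_square_zero:
  fixes n :: nat
  assumes pa: "power_annihilation R" and x: "x \<in> carrier R" and n: "x [^] n = \<zero>"
  shows "x \<otimes> x = \<zero>"
proof (rule ccontr)
  assume nz: "x \<otimes> x \<noteq> \<zero>"
  define k where "k = (LEAST k::nat. x [^] k = \<zero>)"
  have k: "x [^] k = \<zero>"
    unfolding k_def using n by (rule LeastI)
  have sq: "x [^] (2::nat) = x \<otimes> x"
    using x by (simp add: numeral_2_eq_2)
  \<comment> \<open>If \<open>k \<le> 2\<close>, then already \<open>x^2 = 0\<close>.\<close>
  have "k \<ge> 3"
    using pow_zero_mono[OF x k, of 2] nz sq by (cases "k \<le> 2") auto
  define w where "w = x [^] (k - 1)"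
  have w: "w \<in> carrier R"
    unfolding w_def using x by simp
  have w0: "w \<noteq> \<zero>"
    unfolding w_def using not_less_Least[of "k - 1" "\<lambda>k. x [^] k = \<zero>"] \<open>k \<ge> 3\<close>
    by (simp add: k_def[symmetric])
  have wx: "w \<otimes> x = \<zero>"
    using k \<open>k \<ge> 3\<close> nat_pow_Suc[of x "k - 1"] by (simp add: w_def del: nat_pow_Suc)
  \<comment> \<open>The exponent \<open>2 (k - 1)\<close> is at least \<open>k\<close>.\<close>
  have ww: "w \<otimes> w = \<zero>"
    using nat_pow_mult[OF x, of "k - 1" "k - 1"] pow_zero_mono[OF x k, of "k - 1 + (k - 1)"]
      \<open>k \<ge> 3\<close> by (simp add: w_def)
  have xy: "x \<otimes> (x \<oplus> w) = x \<otimes> x"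
    using x w wx by (simp add: r_distr m_comm)
  have y0: "x \<oplus> w \<noteq> \<zero>"
    using xy nz x by auto
  have "x \<oplus> w \<noteq> x"
    using x w w0 by (simp add: add.r_cancel_one)
  \<comment> \<open>This is \<open>w (x + w) = w x + w w\<close>, where both summands
    vanish.\<close>
  moreover have "x [^] (k - 1) \<otimes> (x \<oplus> w) [^] (1::nat) = \<zero>"
    using x w wx ww by (simp add: w_def[symmetric, simplified] r_distr)
  ultimately have "x \<otimes> (x \<oplus> w) = \<zero>"
    using pa[unfolded power_annihilation_def, rule_format, of x "x \<oplus> w" "k - 1" 1]
      x w w0 y0 \<open>k \<ge> 3\<close> unfolding w_def by force
  then show False
    using xy nz by simp
qed

text \<open>For \<open>x = y\<close> the product condition reads \<open>x^(n + m) = 0\<close>, so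
  \<open>x\<close> is nilpotent and its square is zero.\<close>

lemma power_annihilationD:
  fixes n m :: nat
  assumes "power_annihilation R" "x \<in> carrier R" "y \<in> carrier R"
    "x [^] n \<otimes> y [^] m = \<zero>" "x [^] n \<noteq> \<zero>" "y [^] m \<noteq> \<zero>" "n \<ge> 1" "m \<ge> 1"
  shows "x \<otimes> y = \<zero>"
proof (cases "x = y")
  case True
  then have "x [^] (n + m) = \<zero>"
    using assms(2,4) by (simp add: nat_pow_mult)
  then show ?thesis
    using nilpotent_square_zero assms(1,2) True by blast
qed (use assms in \<open>unfold power_annihilation_def, blast\<close>)

text \<open>Since \<open>x^2 = i^2 = 0\<close>, the square of \<open>x + i\<close> is
  \<open>2 x i\<close>, which again squares to zero. Hence \<open>(x + i)^4 = 0\<close>, and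
  \<open>nilpotent_square_zero\<close> lowers the exponent to 2.\<close>

lemma nilpotent_add_square_zero:
  fixes n :: nat
  assumes pa: "power_annihilation R" and x: "x \<in> carrier R" "x [^] n = \<zero>"
    and i: "i \<in> nilpotents R"
  shows "(x \<oplus> i) \<otimes> (x \<oplus> i) = \<zero>"
proof -
  have ic: "i \<in> carrier R" and ii: "i \<otimes> i = \<zero>"
    using i nilpotent_square_zero[OF pa] by (auto simp: nilpotents_def)
  have xx: "x \<otimes> x = \<zero>"
    using nilpotent_square_zero[OF pa x] .
  define p where "p = x \<otimes> i"
  have p: "p \<in> carrier R" unfolding p_def using x ic by simp
  have sq: "(x \<oplus> i) \<otimes> (x \<oplus> i) = p \<oplus> p"
    using x ic xx ii unfolding p_def by (simp add: l_distr r_distr m_comm)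
  have "p \<otimes> p = (x \<otimes> x) \<otimes> (i \<otimes> i)"
    using x ic unfolding p_def by (simp add: m_ac)
  then have "p \<otimes> p = \<zero>" using xx ii by simp
  then have "(p \<oplus> p) \<otimes> (p \<oplus> p) = \<zero>"
    using p by (simp add: l_distr r_distr)
  then have "(x \<oplus> i) [^] (4::nat) = \<zero>"
    using x ic p m_assoc[of "p \<oplus> p" "x \<oplus> i" "x \<oplus> i"] by (simp add: numeral_eq_Suc sq)
  then show ?thesis
    using nilpotent_square_zero[OF pa] x ic by blast
qed

lemma zero_if_pow_zero_translate_nonzero:
  fixes n :: nat
  assumes pa: "power_annihilation R" and x: "x \<in> carrier R" "x [^] n = \<zero>"
    and i: "i \<in> nilpotents R" and nz: "(x \<oplus> i) [^] n \<noteq> \<zero>" and n: "n \<ge> 1"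
  shows "x = \<zero>"
proof -
  have c: "x \<oplus> i \<in> carrier R" using x i by (simp add: nilpotents_def)
  have "(x \<oplus> i) [^] (2::nat) = \<zero>"
    using nilpotent_add_square_zero[OF pa x i] c by (simp add: numeral_2_eq_2)
  then have "n < 2"
    using pow_zero_mono[OF c, of 2 n] nz by force
  then have "n = 1" using n by simp
  then show ?thesis using x by simp
qed

text \<open>Stated for a pair of elements differing by a nilpotent, so that it applies to both
  components of an element of the duplication.\<close>

lemma component_mult_zero:
  fixes n m :: nat
  assumes pa: "power_annihilation R"
    and c: "r \<in> carrier R" "s \<in> carrier R" and i: "i \<in> nilpotents R" "j \<in> nilpotents R"
    and z: "r [^] n \<otimes> s [^] m = \<zero>" and nm: "n \<ge> 1" "m \<ge> 1"
    and nz: "r [^] n \<noteq> \<zero> \<or> (r \<oplus> i) [^] n \<noteq> \<zero>" "s [^] m \<noteq> \<zero> \<or> (s \<oplus> j) [^] m \<noteq> \<zero>"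
  shows "r \<otimes> s = \<zero>"
proof -
  consider "r [^] n = \<zero>" | "s [^] m = \<zero>" | "r [^] n \<noteq> \<zero>" "s [^] m \<noteq> \<zero>"
    by blast
  then show ?thesis
  proof cases
    \<comment> \<open>Here \<open>nz\<close> leaves only \<open>(r + i)^n \<noteq> 0\<close>, which
      forces \<open>r = 0\<close>; the next case is symmetric.\<close>
    case 1
    then show ?thesis
      using zero_if_pow_zero_translate_nonzero[OF pa c(1) 1 i(1)] nz nm c by simp
  next
    case 2
    then show ?thesis
      using zero_if_pow_zero_translate_nonzero[OF pa c(2) 2 i(2)] nz nm c by simp
  next
    case 3
    then show ?thesis
      using power_annihilationD[OF pa c z] nm by blast
  qed
qed

end

lemma amalgamated_duplication_pow:
  fixes n :: nat
  shows "p [^]\<^bsub>amalgamated_duplication R I\<^esub> n = (fst p [^]\<^bsub>R\<^esub> n, snd p [^]\<^bsub>R\<^esub> n)"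
  by (induction n) (simp_all add: nat_pow_def amalgamated_duplication_simps)

lemma power_annihilation_amalgamated_duplication_iff:
  fixes R (structure)
  assumes "cring R" and "ideal I R" and nil: "I \<subseteq> nilpotents R"
  shows "power_annihilation (amalgamated_duplication R I) \<longleftrightarrow> power_annihilation R"
proof -
  interpret cring R by fact
  interpret I: ideal I R by fact
  note S = amalgamated_duplication_simps amalgamated_duplication_carrier_def
    amalgamated_duplication_pow
  let ?D = "amalgamated_duplication R I"
  show ?thesis
  proof
    assume pa: "power_annihilation ?D"
    \<comment> \<open>The diagonal lies in the duplication because \<open>I\<close> contains
      zero.\<close>
    have diag: "(x, x) \<in> carrier ?D" if "x \<in> carrier R" for x
      using that I.zero_closed by (auto simp: S intro!: exI[of _ \<zero>])
    show "power_annihilation R"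
      unfolding power_annihilation_def
    proof (intro ballI allI impI)
      fix x y and n m :: nat
      assume xy: "x \<in> carrier R" "y \<in> carrier R" "x \<noteq> y"
        "x [^] n \<otimes> y [^] m = \<zero>" "x [^] n \<noteq> \<zero>" "y [^] m \<noteq> \<zero>" "n \<ge> 1" "m \<ge> 1"
      have "(x, x) \<otimes>\<^bsub>?D\<^esub> (y, y) = \<zero>\<^bsub>?D\<^esub>"
        by (rule pa[unfolded power_annihilation_def, rule_format, of _ _ n m])
          (use xy diag in \<open>auto simp: amalgamated_duplication_simps(2-5) amalgamated_duplication_pow\<close>)
      then show "x \<otimes> y = \<zero>" by (simp add: S)
    qed
  next
    assume pa: "power_annihilation R"
    show "power_annihilation ?D"
      unfolding power_annihilation_def
    proof (intro ballI allI impI)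
      fix p q and n m :: nat
      assume "p \<in> carrier ?D" "q \<in> carrier ?D"
      then obtain r i s j where
        p: "p = (r, r \<oplus> i)" "r \<in> carrier R" "i \<in> I" and
        q: "q = (s, s \<oplus> j)" "s \<in> carrier R" "j \<in> I"
        by (auto simp: S)
      assume "p [^]\<^bsub>?D\<^esub> n \<otimes>\<^bsub>?D\<^esub> q [^]\<^bsub>?D\<^esub> m = \<zero>\<^bsub>?D\<^esub>"
        "p [^]\<^bsub>?D\<^esub> n \<noteq> \<zero>\<^bsub>?D\<^esub>" "q [^]\<^bsub>?D\<^esub> m \<noteq> \<zero>\<^bsub>?D\<^esub>"
      then have z: "r [^] n \<otimes> s [^] m = \<zero>" "(r \<oplus> i) [^] n \<otimes> (s \<oplus> j) [^] m = \<zero>"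
        and nz: "r [^] n \<noteq> \<zero> \<or> (r \<oplus> i) [^] n \<noteq> \<zero>" "s [^] m \<noteq> \<zero> \<or> (s \<oplus> j) [^] m \<noteq> \<zero>"
        by (auto simp: S p q)
      assume nm: "n \<ge> 1" "m \<ge> 1"
      have ij: "i \<in> carrier R" "j \<in> carrier R"
        using p q I.Icarr by auto
      \<comment> \<open>For the second components the roles are exchanged: \<open>r\<close> is the
        translate of \<open>r + i\<close> by \<open>- i\<close>, which lies in \<open>I\<close> and
        so is nilpotent. The disjunctions in \<open>nz\<close> are symmetric under this
        exchange.\<close>
      have untranslate: "r \<oplus> i \<oplus> \<ominus> i = r" "s \<oplus> j \<oplus> \<ominus> j = s"
        using p q ij by (simp_all add: a_assoc r_neg)
      have "r \<otimes> s = \<zero>"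
        using component_mult_zero[OF pa _ _ _ _ z(1) nm nz] p q nil by blast
      moreover have "(r \<oplus> i) \<otimes> (s \<oplus> j) = \<zero>"
        by (rule component_mult_zero[OF pa _ _ _ _ z(2) nm, of "\<ominus> i" "\<ominus> j"])
          (use p q ij nil nz untranslate in auto)
      ultimately show "p \<otimes>\<^bsub>?D\<^esub> q = \<zero>\<^bsub>?D\<^esub>"
        by (simp add: S p q)
    qed
  qed
qed

theorem theorem2p7:
  fixes R :: "('a, 'b) ring_scheme" and I :: "'a set"
  assumes "cring R"
    and "\<one>\<^bsub>R\<^esub> \<noteq> \<zero>\<^bsub>R\<^esub>"
    and "ideal I R"
    and "I \<subseteq> nilpotents R"
  shows "extended_zero_divisor_graph (amalgamated_duplication R I)
           = zero_divisor_graph (amalgamated_duplication R I)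
         \<longleftrightarrow> extended_zero_divisor_graph R = zero_divisor_graph R"
  using cring.extended_graph_eq_iff[OF amalgamated_duplication_cring[OF assms(1,3)]]
    cring.extended_graph_eq_iff[OF assms(1)]
    power_annihilation_amalgamated_duplication_iff[OF assms(1,3,4)]
  by simp

end
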